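(* Let $d\ge2$ and let $x_1,\dots,x_{d-1}\in\{-1,1\}$ be fixed and known to the statistician. Let $u$ be uniformly random on $\mathcal S^{d-1}$. Conditionally on $u$, let $z_1,\dots,z_{d-1}$ be independent with $z_i\sim\mathcal N(x_iu,I_d-uu^\top)$. Then every estimator $\hat u=\hat u(\{(x_i,z_i)\}_{i=1}^{d-1})\in\mathcal S^{d-1}$ (any measurable function of the data) satisfies $\Pr[\hat u=u]\le1/2$. *)

theory Defs
  imports "HOL-Probability.Probability"
begin

definition std_gauss :: "(real^'n) measure" where
  "std_gauss = density lborel (\<lambda>g. \<Prod>i\<in>UNIV. std_normal_density (g $ i))"

text \<open>Gaussian N(mu, A A^T), defined as the law of mu + A g with g ~ N(0,I) (this allows
  degenerate covariance).\<close>
definition gaussian :: "real^'n \<Rightarrow> real^'n^'n \<Rightarrow> (real^'n) measure" where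
  "gaussian mu A = distr std_gauss borel (\<lambda>g. mu + A *v g)"

definition proj_perp :: "real^'n \<Rightarrow> real^'n^'n" where
  "proj_perp u = mat 1 - (\<chi> i j. u $ i * u $ j)"

text \<open>Uniform (normalized surface) measure on the unit sphere S^{d-1}: the cone measure,
  i.e. the image of the uniform distribution on the unit ball under x \<mapsto> x/|x|.\<close>
definition uniform_sphere :: "(real^'n) measure" where
  "uniform_sphere = distr (uniform_measure lborel (ball 0 1)) borel (\<lambda>x. x /\<^sub>R norm x)"

definition data_space :: "(nat \<Rightarrow> real^'n) measure" where
  "data_space = PiM {..<CARD('n) - 1} (\<lambda>_. borel)"

definition data_given :: "(nat \<Rightarrow> real) \<Rightarrow> real^'n \<Rightarrow> (nat \<Rightarrow> real^'n) measure" where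
  "data_given x u = PiM {..<CARD('n) - 1} (\<lambda>i. gaussian (x i *\<^sub>R u) (proj_perp u))"

end

theory Submission
  imports Defs
begin

text \<open>The data determine \<open>u\<close> only up to a reflection: the \<open>d - 1\<close> observations lie in a hyperplane
  through the origin, and reflecting \<open>u\<close> in that hyperplane gives another direction that explains
  them equally well. To avoid conditioning on the data, write them as a function of latent variables
  \<open>(u, g)\<close> whose law is invariant under the orthogonal group, and rotate \<open>(u, z)\<close> by an independent
  Haar-distributed \<open>Q\<close>, obtained by Gram-Schmidt from an independent copy of \<open>(u, g)\<close>. The success
  probability becomes that of \<open>est (Q z) = Q u\<close>. For fixed \<open>(u, z)\<close> with reflection \<open>f\<close>, the maps \<open>Q\<close>
  and \<open>Q \<circ> f\<close> have the same law and \<open>f\<close> fixes \<open>z\<close>, so \<open>est (Q z) = Q u\<close> and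
  \<open>est (Q z) = Q (f u)\<close> are equally likely; as \<open>f u \<noteq> u\<close>, they are disjoint.\<close>

section \<open>Gram-Schmidt residuals and the orthogonal map they determine\<close>

function gram_schmidt :: "(nat \<Rightarrow> 'a::real_inner) \<Rightarrow> nat \<Rightarrow> 'a" where
  "gram_schmidt s k = s k -
     (\<Sum>j<k. ((s k \<bullet> gram_schmidt s j) / (gram_schmidt s j \<bullet> gram_schmidt s j)) *\<^sub>R gram_schmidt s j)"
  by auto
termination by (relation "Wellfounded.measure snd") auto

declare gram_schmidt.simps[simp del]

text \<open>Vanishing residuals are harmless: the junk value \<open>0 / 0 = 0\<close> drops them from the sum.\<close>

lemma gram_schmidt_orthogonal_less:
  "i < j \<Longrightarrow> gram_schmidt s j \<bullet> gram_schmidt s i = 0"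
proof (induction j arbitrary: i rule: less_induct)
  case (less j)
  let ?r = "gram_schmidt s"
  have ort: "?r l \<bullet> ?r i = 0" if "l < j" "l \<noteq> i" for l
    using less.IH[of l i] less.IH[of i l] less.prems that
    by (cases "i < l") (auto simp: inner_commute)
  have "(\<Sum>l<j. ((s j \<bullet> ?r l) / (?r l \<bullet> ?r l)) * (?r l \<bullet> ?r i)) =
      (\<Sum>l<j. if l = i then s j \<bullet> ?r i else 0)"
    using ort by (intro sum.cong) auto
  then show ?case
    using less.prems by (subst gram_schmidt.simps) (simp add: inner_diff_left inner_sum_left)
qed

lemma gram_schmidt_orthogonal:
  "i \<noteq> j \<Longrightarrow> gram_schmidt s i \<bullet> gram_schmidt s j = 0"
  using gram_schmidt_orthogonal_less[of i j s] gram_schmidt_orthogonal_less[of j i s]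
  by (auto simp: inner_commute neq_iff)

text \<open>The recursion involves only linear combinations and inner products, both of which
  \<open>f\<close> respects.\<close>

lemma gram_schmidt_equivariant:
  assumes f: "orthogonal_transformation f"
  shows "gram_schmidt (\<lambda>i. f (s i)) k = f (gram_schmidt s k)"
proof (induction k rule: less_induct)
  case (less k)
  note lin = orthogonal_transformation_linear[OF f]
  have "f v \<bullet> f w = v \<bullet> w" for v w
    using f by (simp add: orthogonal_transformation_def)
  then show ?case
    using less by (subst (1 2) gram_schmidt.simps)
      (simp add: linear_diff[OF lin] linear_sum[OF lin] linear_scale[OF lin])
qed

lemma gram_schmidt_in_span: "gram_schmidt s k \<in> span (s ` {..k})"
proof (induction k rule: less_induct)
  case (less k)
  have "gram_schmidt s j \<in> span (s ` {..k})" if "j < k" for j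
    using less[OF that] that
    by (elim rev_subsetD[OF _ span_mono]) auto
  then show ?case
    by (subst gram_schmidt.simps) (intro span_diff span_sum span_scale; simp add: span_base)
qed

text \<open>A zero residual means that \<open>s k\<close> equals the subtracted sum, whose terms lie
  in the span of the earlier vectors. Used contrapositively, to show that random vectors leave
  nonzero residuals.\<close>

lemma gram_schmidt_eq_0D:
  assumes "gram_schmidt s k = 0"
  shows "s k \<in> span (s ` {..<k})"
proof -
  have "gram_schmidt s j \<in> span (s ` {..<k})" if "j < k" for j
    using gram_schmidt_in_span[of s j] that
    by (elim rev_subsetD[OF _ span_mono]) auto
  then have "(\<Sum>j<k. ((s k \<bullet> gram_schmidt s j) / (gram_schmidt s j \<bullet> gram_schmidt s j)) *\<^sub>R
      gram_schmidt s j) \<in> span (s ` {..<k})"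
    by (intro span_sum span_scale) auto
  then show ?thesis
    using assms by (subst (asm) (1) gram_schmidt.simps) auto
qed

lemma measurable_gram_schmidt:
  fixes s :: "'b \<Rightarrow> nat \<Rightarrow> 'a::euclidean_space"
  assumes "\<And>j. j \<le> k \<Longrightarrow> (\<lambda>w. s w j) \<in> borel_measurable M"
  shows "(\<lambda>w. gram_schmidt (s w) k) \<in> borel_measurable M"
  using assms
proof (induction k rule: less_induct)
  case (less k)
  have [measurable]: "(\<lambda>w. gram_schmidt (s w) j) \<in> borel_measurable M" if "j < k" for j
    using less.IH[OF that] less.prems that by auto
  have [measurable]: "(\<lambda>w. s w k) \<in> borel_measurable M"
    using less.prems by auto
  show ?case
    by (subst gram_schmidt.simps) measurable
qed

text \<open>The inverse of the isometry taking the basis \<open>b\<close> to the normalized residuals; this form makes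
  measurability in \<open>s\<close> and right equivariance (\<open>frame_map_comp\<close>) evident.\<close>

definition frame_map :: "(nat \<Rightarrow> 'a::euclidean_space) \<Rightarrow> (nat \<Rightarrow> 'a) \<Rightarrow> 'a \<Rightarrow> 'a" where
  "frame_map b s v = (\<Sum>k<DIM('a). (sgn (gram_schmidt s k) \<bullet> v) *\<^sub>R b k)"

text \<open>Residuals and argument move together, so the inner products that serve as coordinates do
  not change.\<close>

lemma frame_map_comp:
  assumes f: "orthogonal_transformation f"
  shows "frame_map b (\<lambda>i. f (s i)) (f v) = frame_map b s v"
proof -
  note lin = orthogonal_transformation_linear[OF f]
  have "f v \<bullet> f w = v \<bullet> w" for v w
    using f by (simp add: orthogonal_transformation_def)
  then show ?thesis
    by (simp add: frame_map_def gram_schmidt_equivariant[OF f] sgn_div_norm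
        orthogonal_transformation_norm[OF f] linear_scale[OF lin, symmetric])
qed

text \<open>The normalized residuals are orthonormal, so the linear map \<open>R\<close> taking
  \<open>b k\<close> to \<open>q k\<close> is an isometry; the coordinates
  \<open>q k \<bullet> v\<close> identify \<open>frame_map b s\<close> as its inverse.\<close>

lemma orthogonal_transformation_frame_map:
  fixes b s :: "nat \<Rightarrow> 'a::euclidean_space"
  assumes b: "bij_betw b {..<DIM('a)} Basis"
    and s: "\<And>k. k < DIM('a) \<Longrightarrow> gram_schmidt s k \<noteq> 0"
  shows "orthogonal_transformation (frame_map b s)"
proof -
  let ?d = "DIM('a)"
  define q where "q k = sgn (gram_schmidt s k)" for k
  have q: "q i \<bullet> q j = (if i = j then 1 else 0)" if "i < ?d" "j < ?d" for i j
    using gram_schmidt_orthogonal[of i j s] s[of i] that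
    by (auto simp: q_def sgn_div_norm dot_square_norm power2_eq_square field_simps)
  have bb: "b i \<bullet> b j = (if i = j then 1 else 0)" if "i < ?d" "j < ?d" for i j
  proof -
    have "b i \<in> Basis" "b j \<in> Basis" "b i = b j \<longleftrightarrow> i = j"
      using b that by (auto simp: bij_betw_def inj_on_def)
    then show ?thesis by (simp add: inner_Basis)
  qed
  have rep: "(\<Sum>k<?d. (b k \<bullet> v) *\<^sub>R b k) = v" for v
    using sum.reindex_bij_betw[OF b, of "\<lambda>e. (e \<bullet> v) *\<^sub>R e"]
    by (simp add: inner_commute[of _ v] euclidean_representation)
  define R where "R v = (\<Sum>k<?d. (b k \<bullet> v) *\<^sub>R q k)" for v
  have inner_R: "R v \<bullet> R w = v \<bullet> w" for v w
  proof -
    have "R v \<bullet> R w = (\<Sum>i<?d. \<Sum>j<?d. if i = j then (b i \<bullet> v) * (b j \<bullet> w) else 0)"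
      unfolding R_def inner_sum_left inner_sum_right
      by (intro sum.cong) (auto simp: q)
    also have "\<dots> = (\<Sum>k<?d. (b k \<bullet> v) *\<^sub>R b k) \<bullet> w"
      by (simp add: inner_sum_left)
    finally show ?thesis by (simp add: rep)
  qed
  have "linear R"
    unfolding R_def by (intro linearI)
      (simp_all add: inner_add_right sum.distrib scaleR_add_left scaleR_sum_right)
  with inner_R have R: "orthogonal_transformation R"
    by (simp add: orthogonal_transformation_def)
  have Rb: "R (b k) = q k" if "k < ?d" for k
  proof -
    have "R (b k) = (\<Sum>i<?d. if i = k then q i else 0)"
      unfolding R_def using that by (intro sum.cong) (auto simp: bb)
    then show ?thesis using that by simp
  qed
  have "frame_map b s v = inv R v" for v
  proof -
    have "v = R (inv R v)"
      using orthogonal_transformation_surj[OF R] by (simp add: surj_f_inv_f)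
    \<comment> \<open>Pair \<open>R (inv R v)\<close> with \<open>q k = R (b k)\<close> and drop
      \<open>R\<close> from both sides.\<close>
    then have "q k \<bullet> v = b k \<bullet> inv R v" if "k < ?d" for k
      using inner_R[of "b k" "inv R v"] Rb[OF that] by simp
    then have "frame_map b s v = (\<Sum>k<?d. (b k \<bullet> inv R v) *\<^sub>R b k)"
      by (simp add: frame_map_def q_def)
    then show ?thesis by (simp add: rep)
  qed
  then have "frame_map b s = inv R" by auto
  then show ?thesis using orthogonal_transformation_inv[OF R] by simp
qed

lemma orthogonal_transformation_reflection:
  fixes n :: "'a::real_inner"
  assumes "norm n = 1"
  shows "orthogonal_transformation (\<lambda>v. v - (2 * (n \<bullet> v)) *\<^sub>R n)"
proof -
  have "n \<bullet> n = 1" using assms by (simp add: dot_square_norm)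
  then show ?thesis
    unfolding orthogonal_transformation_def
    by (intro conjI linearI allI)
      (simp_all add: algebra_simps inner_commute)
qed

section \<open>Orthogonal invariance of Lebesgue measure and of densities\<close>

lemma nn_integral_lborel_reflect:
  fixes c :: "'a::euclidean_space"
  assumes [measurable]: "h \<in> borel_measurable borel"
  shows "(\<integral>\<^sup>+y. h (c - y) \<partial>lborel) = (\<integral>\<^sup>+y. h y \<partial>lborel)"
proof -
  have "lborel = distr lborel borel (\<lambda>y. c - y)"
    using lborel_affine[of "-1" c] by (simp add: density_1)
  then have "(\<integral>\<^sup>+y. h y \<partial>lborel) = (\<integral>\<^sup>+y. h y \<partial>distr lborel borel (\<lambda>y. c - y))"
    by simp
  then show ?thesis by (simp add: nn_integral_distr)
qed

lemma nn_integral_lborel_shift: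
  fixes c :: "'a::euclidean_space"
  assumes [measurable]: "h \<in> borel_measurable borel"
  shows "(\<integral>\<^sup>+y. h (c + y) \<partial>lborel) = (\<integral>\<^sup>+y. h y \<partial>lborel)"
proof -
  have "(\<integral>\<^sup>+y. h y \<partial>lborel) = (\<integral>\<^sup>+y. h y \<partial>distr lborel borel ((+) c))"
    by (simp add: lborel_distr_plus)
  then show ?thesis by (simp add: nn_integral_distr)
qed

lemma measurable_orthogonal_transformation:
  fixes f :: "'a::euclidean_space \<Rightarrow> 'a"
  assumes "orthogonal_transformation f"
  shows "f \<in> borel_measurable borel"
  using assms by (intro borel_measurable_continuous_onI linear_continuous_on)
    (simp add: linear_conv_bounded_linear[symmetric] orthogonal_transformation_linear)

lemma vimage_ball_orthogonal_transformation:
  assumes "orthogonal_transformation f"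
  shows "f -` ball 0 r = ball 0 r"
  using orthogonal_transformation_norm[OF assms] by auto

text \<open>Uniqueness of Haar measure on the additive group: Fubini is applied to
  \<open>1\<^sub>A(f x) 1\<^sub>B(y + f x)\<close>, where the unit ball \<open>B\<close> fixes the constant.\<close>

lemma distr_lborel_orthogonal_transformation:
  fixes f :: "'a::euclidean_space \<Rightarrow> 'a"
  assumes f: "orthogonal_transformation f"
  shows "distr lborel borel f = lborel"
proof (rule measure_eqI)
  note [measurable] = measurable_orthogonal_transformation[OF f]
  note lin = orthogonal_transformation_linear[OF f]
  fix A :: "'a set" assume "A \<in> sets (distr lborel borel f)"
  then have [measurable]: "A \<in> sets borel" by simp
  let ?B = "ball 0 1 :: 'a set"
  have [measurable]: "?B \<in> sets borel" by simp
  let ?a = "\<lambda>x. indicator A x :: ennreal" and ?b = "\<lambda>x. indicator ?B x :: ennreal"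
  have mu: "emeasure (distr lborel borel f) S = (\<integral>\<^sup>+x. indicator S (f x) \<partial>lborel)"
    if [measurable]: "S \<in> sets borel" for S
  proof -
    have "emeasure (distr lborel borel f) S = (\<integral>\<^sup>+x. indicator S x \<partial>distr lborel borel f)"
      by simp
    also have "\<dots> = (\<integral>\<^sup>+x. indicator S (f x) \<partial>lborel)"
      by (rule nn_integral_distr) auto
    finally show ?thesis .
  qed
  have shift: "(\<integral>\<^sup>+y. ?b (c + y) \<partial>lborel) = emeasure lborel ?B" for c
    by (subst nn_integral_lborel_shift) (auto intro!: borel_measurable_indicator)
  have reflect: "(\<integral>\<^sup>+y. ?a (c - y) \<partial>lborel) = emeasure lborel A" for c
    by (subst nn_integral_lborel_reflect) (auto intro!: borel_measurable_indicator)
  \<comment> \<open>First evaluation: for fixed \<open>x\<close>, the integral over \<open>y\<close>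
    is the volume of \<open>?B\<close>.\<close>
  have "emeasure (distr lborel borel f) A * emeasure lborel ?B =
      (\<integral>\<^sup>+x. ?a (f x) * (\<integral>\<^sup>+y. ?b (f x + y) \<partial>lborel) \<partial>lborel)"
    by (simp add: mu shift nn_integral_multc)
  also have "\<dots> = (\<integral>\<^sup>+x. (\<integral>\<^sup>+y. ?a (f x) * ?b (f x + y) \<partial>lborel) \<partial>lborel)"
    by (intro nn_integral_cong nn_integral_cmult[symmetric]) measurable
  also have "\<dots> = (\<integral>\<^sup>+y. (\<integral>\<^sup>+x. ?a (f x) * ?b (f x + y) \<partial>lborel) \<partial>lborel)"
    by (rule lborel_pair.Fubini'[symmetric]) measurable
  also have "\<dots> = (\<integral>\<^sup>+y. (\<integral>\<^sup>+x. ?a (f x - y) * ?b (f x) \<partial>lborel) \<partial>lborel)"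
  proof (rule nn_integral_cong)
    fix y :: 'a
    \<comment> \<open>Translating \<open>f x\<close> by \<open>y\<close> amounts to translating
      \<open>x\<close> by a preimage \<open>c\<close> of \<open>y\<close>, which Lebesgue measure
      absorbs.\<close>
    obtain c where c: "f c = y"
      using orthogonal_transformation_surj[OF f] by (metis surjD)
    have "(\<integral>\<^sup>+x. ?a (f x) * ?b (f x + y) \<partial>lborel) =
        (\<integral>\<^sup>+x. ?a (f (-c + x)) * ?b (f (-c + x) + y) \<partial>lborel)"
      by (rule nn_integral_lborel_shift[symmetric]) measurable
    also have "\<dots> = (\<integral>\<^sup>+x. ?a (f x - y) * ?b (f x) \<partial>lborel)"
      by (simp add: linear_diff[OF lin] c)
    finally show "(\<integral>\<^sup>+x. ?a (f x) * ?b (f x + y) \<partial>lborel) =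
        (\<integral>\<^sup>+x. ?a (f x - y) * ?b (f x) \<partial>lborel)" .
  qed
  also have "\<dots> = (\<integral>\<^sup>+x. (\<integral>\<^sup>+y. ?a (f x - y) * ?b (f x) \<partial>lborel) \<partial>lborel)"
    by (rule lborel_pair.Fubini') measurable
  \<comment> \<open>Second evaluation: now the integral over \<open>y\<close> yields the volume of
    \<open>A\<close>, and \<open>?B\<close> is left with the pushed-forward measure.\<close>
  also have "\<dots> = (\<integral>\<^sup>+x. emeasure lborel A * ?b (f x) \<partial>lborel)"
    by (simp add: nn_integral_multc reflect)
  also have "\<dots> = emeasure lborel A * emeasure (distr lborel borel f) ?B"
    by (simp add: mu nn_integral_cmult)
  also have "emeasure (distr lborel borel f) ?B = emeasure lborel ?B"
    by (simp add: emeasure_distr vimage_ball_orthogonal_transformation[OF f])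
  finally have "emeasure (distr lborel borel f) A * emeasure lborel ?B =
      emeasure lborel A * emeasure lborel ?B" .
  moreover have "emeasure lborel ?B \<noteq> 0"
    using emeasure_lborel_ball_finite[of "0::'a" 1] content_ball_pos[of 1 "0::'a"]
    by (auto simp: measure_def)
  moreover have "emeasure lborel ?B \<noteq> \<top>"
    using emeasure_lborel_ball_finite[of "0::'a" 1] by auto
  ultimately show "emeasure (distr lborel borel f) A = emeasure lborel A"
    by (metis mult_divide_eq_ennreal)
qed simp

text \<open>Applied to Lebesgue measure with the Gaussian density and with the normalized indicator
  of the unit ball; both depend on the norm alone.\<close>

lemma distr_density_invariant:
  assumes f: "f \<in> measurable M M" and inv: "distr M M f = M"
    and h[measurable]: "h \<in> borel_measurable M" and eq: "\<And>x. x \<in> space M \<Longrightarrow> h (f x) = h x"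
  shows "distr (density M h) M f = density M h"
proof -
  note [measurable] = f
  have "density M h = density (distr M M f) h" by (simp add: inv)
  also have "\<dots> = distr (density M (\<lambda>x. h (f x))) M f"
    by (rule density_distr) auto
  also have "density M (\<lambda>x. h (f x)) = density M h"
    by (intro density_cong) (auto simp: eq)
  finally show ?thesis ..
qed

section \<open>The standard Gaussian: normalization, rotation invariance, null subspaces\<close>

lemma density_std_gauss:
  "(\<Prod>i\<in>UNIV. std_normal_density (g $ i)) =
    (1 / sqrt (2 * pi)) ^ CARD('n) * exp (- (norm g)\<^sup>2 / 2)" for g :: "real^'n"
proof -
  have "(norm g)\<^sup>2 = (\<Sum>i\<in>UNIV. (g $ i)\<^sup>2)"
    by (simp add: norm_vec_def L2_set_def sum_nonneg)
  then have "- (norm g)\<^sup>2 / 2 = (\<Sum>i\<in>UNIV. - (g $ i)\<^sup>2 / 2)"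
    by (simp add: sum_negf sum_divide_distrib)
  then show ?thesis
    by (simp only: std_normal_density_def prod.distrib prod_constant exp_sum finite)
qed

lemma sets_std_gauss [measurable_cong, simp]: "sets std_gauss = sets borel"
  by (simp add: std_gauss_def)

lemma space_std_gauss [simp]: "space std_gauss = UNIV"
  by (simp add: std_gauss_def)

lemma prob_space_std_gauss: "prob_space (std_gauss :: (real^'n) measure)"
proof
  interpret N: prob_space "density lborel std_normal_density"
    by (rule prob_space_normal_density) simp
  have one: "(\<integral>\<^sup>+x. ennreal (std_normal_density x) \<partial>lborel) = 1"
    using N.emeasure_space_1 by (simp add: emeasure_density)
  \<comment> \<open>The basis of \<open>real^'n\<close> is indexed by the coordinates, so the
    density is a product over \<open>Basis\<close> and its integral factors into one-dimensional
    ones.\<close>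
  have bas: "(Basis :: (real^'n) set) = range (\<lambda>i. axis i 1)"
    by (auto simp: Basis_vec_def)
  have inj: "inj (\<lambda>i::'n. axis i (1::real))"
    by (auto simp: inj_def axis_eq_axis)
  have "emeasure (std_gauss :: (real^'n) measure) (space std_gauss) =
      (\<integral>\<^sup>+g. (\<Prod>i\<in>UNIV. ennreal (std_normal_density ((g::real^'n) $ i))) \<partial>lborel)"
    by (simp add: std_gauss_def emeasure_density prod_ennreal)
  also have "\<dots> = (\<integral>\<^sup>+g. (\<Prod>b\<in>Basis. ennreal (std_normal_density ((g::real^'n) \<bullet> b))) \<partial>lborel)"
    by (simp add: bas prod.reindex[OF inj] inner_axis)
  also have "\<dots> = 1"
    by (subst nn_integral_lborel_prod) (simp_all add: one)
  finally show "emeasure (std_gauss :: (real^'n) measure) (space std_gauss) = 1" .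
qed

lemma std_gauss_orthogonal_invariant:
  fixes f :: "real^'n \<Rightarrow> real^'n"
  assumes f: "orthogonal_transformation f"
  shows "distr std_gauss borel f = std_gauss"
proof -
  have "distr std_gauss lborel f = std_gauss"
    unfolding std_gauss_def
    using measurable_orthogonal_transformation[OF f] distr_lborel_orthogonal_transformation[OF f]
    by (intro distr_density_invariant)
      (auto simp: density_std_gauss orthogonal_transformation_norm[OF f] cong: distr_cong)
  then show ?thesis by (simp cong: distr_cong)
qed

text \<open>Too few vectors span a proper subspace, which is Lebesgue null, and the Gaussian has a
  density.\<close>

lemma std_gauss_proper_span:
  fixes S :: "(real^'n) set"
  assumes "finite S" "card S < CARD('n)"
  shows "AE y in std_gauss. y \<notin> span S"
proof -
  have "dim (span S) < DIM(real^'n)"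
    using assms dim_le_card'[of S] by simp
  then have "span S \<in> null_sets lebesgue"
    using negligible_lowdim negligible_iff_null_sets by blast
  \<comment> \<open>Negligibility concerns the completed measure; closedness makes the span Borel,
    so nullness passes to \<open>lborel\<close>.\<close>
  moreover have "span S \<in> sets borel"
    by (intro borel_closed closed_span)
  ultimately have "span S \<in> null_sets lborel"
    by (simp add: null_sets_completion_iff)
  then have "AE y in lborel. y \<notin> span S" by (rule AE_not_in)
  then show ?thesis
    unfolding std_gauss_def by (subst AE_density) auto
qed

section \<open>The uniform distribution on the sphere\<close>

lemma prob_space_uniform_ball: "prob_space (uniform_measure lborel (ball 0 1 :: 'a::euclidean_space set))"
proof (rule prob_space_uniform_measure)
  show "emeasure lborel (ball 0 1 :: 'a set) \<noteq> 0"
    using emeasure_lborel_ball_finite[of "0::'a" 1] content_ball_pos[of 1 "0::'a"]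
    by (auto simp: measure_def)
qed (use emeasure_lborel_ball_finite[of "0::'a" 1] in auto)

lemma sets_uniform_sphere [measurable_cong, simp]: "sets uniform_sphere = sets borel"
  by (simp add: uniform_sphere_def)

lemma space_uniform_sphere [simp]: "space uniform_sphere = UNIV"
  by (simp add: uniform_sphere_def)

lemma prob_space_uniform_sphere: "prob_space uniform_sphere"
  unfolding uniform_sphere_def
  by (rule prob_space.prob_space_distr[OF prob_space_uniform_ball]) simp

text \<open>The uniform law on the ball is invariant, and radial normalization commutes with
  \<open>f\<close>, which is linear and preserves norms.\<close>

lemma uniform_sphere_orthogonal_invariant:
  fixes f :: "real^'n \<Rightarrow> real^'n"
  assumes f: "orthogonal_transformation f"
  shows "distr uniform_sphere borel f = uniform_sphere"
proof -
  note [measurable] = measurable_orthogonal_transformation[OF f]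
  let ?B = "uniform_measure lborel (ball 0 1 :: (real^'n) set)"
  have "f x \<in> ball 0 1 \<longleftrightarrow> x \<in> ball 0 1" for x
    using orthogonal_transformation_norm[OF f, of x] by simp
  then have "distr ?B lborel f = ?B"
    unfolding uniform_measure_def
    using distr_lborel_orthogonal_transformation[OF f]
    by (intro distr_density_invariant) (auto simp: indicator_def cong: distr_cong)
  then have ball: "distr ?B borel f = ?B" by (simp cong: distr_cong)
  have "distr uniform_sphere borel f = distr ?B borel (\<lambda>x. f (x /\<^sub>R norm x))"
    unfolding uniform_sphere_def by (subst distr_distr) (auto simp: comp_def)
  also have "\<dots> = distr ?B borel ((\<lambda>x. x /\<^sub>R norm x) \<circ> f)"
    by (simp add: comp_def orthogonal_transformation_norm[OF f] orthogonal_transformation_scaleR[OF f])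
  also have "\<dots> = distr (distr ?B borel f) borel (\<lambda>x. x /\<^sub>R norm x)"
    by (subst distr_distr) auto
  finally show ?thesis by (simp add: ball uniform_sphere_def)
qed

text \<open>Since \<open>inverse 0 = 0\<close>, normalization sends the centre of the ball to 0; it
  is the only point sent there, and it is null.\<close>

lemma AE_uniform_sphere_nonzero: "AE u in uniform_sphere. u \<noteq> 0"
proof -
  have "AE x::real^'n in lborel. x \<noteq> 0"
    by (intro AE_I'[of "{0}"]) auto
  then have "AE x in uniform_measure lborel (ball 0 1 :: (real^'n) set). x \<noteq> 0"
    by (intro AE_uniform_measureI) auto
  then show ?thesis
    unfolding uniform_sphere_def by (subst AE_distr_iff) auto
qed

section \<open>Push-forwards of products, and the latent model\<close>

lemma distr_PiM_componentwise:
  assumes "finite I"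
    and M: "\<And>i. i \<in> I \<Longrightarrow> prob_space (M i)"
    and f[measurable]: "\<And>i. i \<in> I \<Longrightarrow> f i \<in> measurable (M i) (M' i)"
  shows "distr (PiM I M) (PiM I M') (\<lambda>g. \<lambda>i\<in>I. f i (g i)) = PiM I (\<lambda>i. distr (M i) (M' i) (f i))"
proof -
  \<comment> \<open>\<open>product_prob_space\<close> asks for a probability measure at every index,
    so both families are padded with a point mass outside \<open>I\<close>.\<close>
  define N where "N = (\<lambda>i. if i \<in> I then M i else return (count_space UNIV) undefined)"
  define K where "K = (\<lambda>i. if i \<in> I then distr (M i) (M' i) (f i) else return (count_space UNIV) undefined)"
  interpret N: product_prob_space N
    by (rule product_prob_spaceI) (auto simp: N_def intro!: prob_space_return M)
  interpret K: product_prob_space K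
    by (rule product_prob_spaceI) (auto simp: K_def intro!: prob_space_return prob_space.prob_space_distr M)
  have NM: "PiM I N = PiM I M" and KM: "PiM I K = PiM I (\<lambda>i. distr (M i) (M' i) (f i))"
    by (intro PiM_cong; simp add: N_def K_def)+
  interpret F: finite_product_prob_space N I
    by standard fact
  have meas: "(\<lambda>g. \<lambda>i\<in>I. f i (g i)) \<in> measurable (PiM I M) (PiM I M')"
    by measurable
  have "distr (PiM I M) (PiM I M') (\<lambda>g. \<lambda>i\<in>I. f i (g i)) = PiM I K"
  proof (rule K.PiM_eqI)
    show "sets (distr (PiM I M) (PiM I M') (\<lambda>g. \<lambda>i\<in>I. f i (g i))) = sets (PiM I K)"
      by (auto simp: K_def intro!: sets_PiM_cong)
    fix A assume "\<And>i. i \<in> I \<Longrightarrow> A i \<in> sets (K i)"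
    then have A[measurable]: "\<And>i. i \<in> I \<Longrightarrow> A i \<in> sets (M' i)" by (simp add: K_def)
    have "emeasure (distr (PiM I M) (PiM I M') (\<lambda>g. \<lambda>i\<in>I. f i (g i))) (Pi\<^sub>E I A) =
        emeasure (PiM I M) ((\<lambda>g. \<lambda>i\<in>I. f i (g i)) -` Pi\<^sub>E I A \<inter> space (PiM I M))"
      using assms(1) A by (intro emeasure_distr meas sets_PiM_I_finite) auto
    \<comment> \<open>The preimage of a box is again a box, so its measure factors.\<close>
    also have "(\<lambda>g. \<lambda>i\<in>I. f i (g i)) -` Pi\<^sub>E I A \<inter> space (PiM I M) =
        (\<Pi>\<^sub>E i\<in>I. f i -` A i \<inter> space (M i))"
      by (auto simp: space_PiM PiE_iff extensional_def)
    also have "emeasure (PiM I M) \<dots> = (\<Prod>i\<in>I. emeasure (M i) (f i -` A i \<inter> space (M i)))"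
    proof -
      have "emeasure (PiM I N) (\<Pi>\<^sub>E i\<in>I. f i -` A i \<inter> space (M i)) =
          (\<Prod>i\<in>I. emeasure (N i) (f i -` A i \<inter> space (M i)))"
        using A by (intro F.measure_times) (auto simp: N_def intro: measurable_sets[OF f])
      then show ?thesis by (simp add: NM) (simp add: N_def)
    qed
    also have "\<dots> = (\<Prod>i\<in>I. emeasure (K i) (A i))"
      by (intro prod.cong) (auto simp: K_def emeasure_distr)
    finally show "emeasure (distr (PiM I M) (PiM I M') (\<lambda>g. \<lambda>i\<in>I. f i (g i))) (Pi\<^sub>E I A) =
        (\<Prod>i\<in>I. emeasure (K i) (A i))" .
  qed fact
  then show ?thesis by (simp add: KM)
qed

text \<open>The noise is drawn before projection, hence independently of the direction; the
  dependence enters only through \<open>obs\<close>.\<close>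

definition latent :: "((real^'n) \<times> (nat \<Rightarrow> real^'n)) measure" where
  "latent = uniform_sphere \<Otimes>\<^sub>M PiM {..<CARD('n) - 1} (\<lambda>_. std_gauss)"

text \<open>Defined as \<open>0\<close> beyond index \<open>d - 1\<close> so that equivariance (\<open>frame_act\<close>) holds at every index.\<close>

definition frame :: "(real^'n) \<times> (nat \<Rightarrow> real^'n) \<Rightarrow> nat \<Rightarrow> real^'n" where
  "frame w k = (case k of 0 \<Rightarrow> fst w | Suc i \<Rightarrow> if i < CARD('n) - 1 then snd w i else 0)"

text \<open>The restriction keeps the noise family extensional, as the space of \<open>PiM\<close>
  demands.\<close>

definition act :: "(real^'n \<Rightarrow> real^'n) \<Rightarrow> (real^'n) \<times> (nat \<Rightarrow> real^'n) \<Rightarrow>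
    (real^'n) \<times> (nat \<Rightarrow> real^'n)" where
  "act f = (\<lambda>(u, g). (f u, \<lambda>i\<in>{..<CARD('n) - 1}. f (g i)))"

definition obs :: "(nat \<Rightarrow> real) \<Rightarrow> (real^'n) \<times> (nat \<Rightarrow> real^'n) \<Rightarrow> nat \<Rightarrow> real^'n" where
  "obs x w = (\<lambda>i\<in>{..<CARD('n) - 1}. x i *\<^sub>R fst w + (snd w i - (fst w \<bullet> snd w i) *\<^sub>R fst w))"

lemma proj_perp_mult: "proj_perp u *v y = y - (u \<bullet> y) *\<^sub>R u"
proof -
  have "(\<chi> i j. u $ i * u $ j) *v y = (u \<bullet> y) *\<^sub>R u"
    by (simp add: vec_eq_iff matrix_vector_mult_def inner_vec_def sum_distrib_left mult_ac)
  then show ?thesis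
    by (simp add: proj_perp_def matrix_vector_mult_diff_rdistrib)
qed

lemma data_given_eq_distr:
  "data_given x u = distr (PiM {..<CARD('n) - 1} (\<lambda>_. std_gauss)) data_space (\<lambda>g. obs x (u, g))"
  for u :: "real^'n"
proof -
  have "data_given x u = distr (PiM {..<CARD('n) - 1} (\<lambda>_. std_gauss)) data_space
      (\<lambda>g. \<lambda>i\<in>{..<CARD('n) - 1}. x i *\<^sub>R u + (g i - (u \<bullet> g i) *\<^sub>R u))"
    unfolding data_given_def gaussian_def proj_perp_mult data_space_def
    by (rule distr_PiM_componentwise[symmetric]) (auto simp: prob_space_std_gauss)
  then show ?thesis by (simp add: obs_def cong: restrict_cong)
qed

lemma act_orthogonal_invariant:
  fixes f :: "real^'n \<Rightarrow> real^'n"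
  assumes f: "orthogonal_transformation f"
  shows "distr latent latent (act f) = latent"
proof -
  note [measurable] = measurable_orthogonal_transformation[OF f]
  let ?N = "PiM {..<CARD('n) - 1} (\<lambda>_. std_gauss :: (real^'n) measure)"
  have U: "distr uniform_sphere uniform_sphere f = uniform_sphere"
    using uniform_sphere_orthogonal_invariant[OF f] by (simp cong: distr_cong)
  have "distr std_gauss std_gauss f = std_gauss"
    using std_gauss_orthogonal_invariant[OF f] by (simp cong: distr_cong)
  then have N: "distr ?N ?N (\<lambda>g. \<lambda>i\<in>{..<CARD('n) - 1}. f (g i)) = ?N"
    by (subst distr_PiM_componentwise) (auto simp: prob_space_std_gauss)
  interpret N: prob_space ?N
    by (intro prob_space_PiM prob_space_std_gauss)
  \<comment> \<open>\<open>pair_measure_distr\<close> needs this for the second push-forward, which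
    equals the probability measure \<open>?N\<close>.\<close>
  have "sigma_finite_measure (distr ?N ?N (\<lambda>g. \<lambda>i\<in>{..<CARD('n) - 1}. f (g i)))"
    unfolding N by unfold_locales
  then have "distr uniform_sphere uniform_sphere f \<Otimes>\<^sub>M distr ?N ?N (\<lambda>g. \<lambda>i\<in>{..<CARD('n) - 1}. f (g i)) =
      distr latent latent (act f)"
    unfolding latent_def act_def by (intro pair_measure_distr) measurable
  then show ?thesis by (simp only: U N latent_def)
qed

lemma prob_space_latent: "prob_space latent"
  unfolding latent_def
  by (intro prob_space_pair prob_space_uniform_sphere prob_space_PiM prob_space_std_gauss)

section \<open>Measurability, equivariance, general position and the reflection\<close>

lemma measurable_fst_latent [measurable]: "fst \<in> borel_measurable latent"
  unfolding latent_def by measurable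

lemma measurable_snd_latent [measurable]:
  "i < CARD('n) - 1 \<Longrightarrow> (\<lambda>w. snd w i) \<in> borel_measurable (latent :: ((real^'n) \<times> (nat \<Rightarrow> real^'n)) measure)"
  unfolding latent_def by measurable

lemma measurable_frame [measurable]: "(\<lambda>w. frame w k :: real^'n) \<in> borel_measurable latent"
proof (cases k)
  case (Suc i)
  then show ?thesis
    by (cases "i < CARD('n) - 1") (simp_all add: frame_def del: One_nat_def)
qed (simp add: frame_def)

lemma measurable_gram_schmidt_frame [measurable]:
  "(\<lambda>w. gram_schmidt (frame w) k) \<in> borel_measurable latent"
  by (rule measurable_gram_schmidt) measurable

lemma measurable_act:
  fixes f :: "real^'n \<Rightarrow> real^'n"
  assumes "orthogonal_transformation f"
  shows "act f \<in> measurable latent latent"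
proof -
  note [measurable] = measurable_orthogonal_transformation[OF assms]
  show ?thesis unfolding latent_def act_def by measurable
qed

lemma frame_act:
  assumes "orthogonal_transformation f"
  shows "frame (act f w) = (\<lambda>k. f (frame w k))"
  by (cases w) (auto simp: fun_eq_iff frame_def act_def
      linear_0[OF orthogonal_transformation_linear[OF assms]] split: nat.split)

text \<open>\<open>obs\<close> is built from inner products and linear operations, so rotating the
  latent variables rotates data and direction together.\<close>

lemma obs_act:
  fixes f :: "real^'n \<Rightarrow> real^'n"
  assumes f: "orthogonal_transformation f"
  shows "obs x (act f w) = (\<lambda>i\<in>{..<CARD('n) - 1}. f (obs x w i))"
proof -
  note lin = orthogonal_transformation_linear[OF f]
  have "f v \<bullet> f w = v \<bullet> w" for v w
    using f by (simp add: orthogonal_transformation_def)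
  then show ?thesis
    by (auto simp: fun_eq_iff obs_def act_def linear_add[OF lin] linear_diff[OF lin]
        linear_scale[OF lin] split: prod.split)
qed

text \<open>Vector 0 is the direction, almost surely nonzero. A later vector \<open>k\<close> is
  Gaussian and independent of the \<open>k\<close> earlier ones; as \<open>k < CARD('n)\<close>, it
  almost surely avoids their span.\<close>

lemma AE_frame_independent:
  "AE w in (latent :: ((real^'n) \<times> (nat \<Rightarrow> real^'n)) measure).
    \<forall>k<CARD('n). gram_schmidt (frame w) k \<noteq> 0"
proof -
  let ?I = "{..<CARD('n) - 1}"
  let ?N = "PiM ?I (\<lambda>_. std_gauss :: (real^'n) measure)"
  interpret N: prob_space ?N
    by (intro prob_space_PiM prob_space_std_gauss)
  interpret U: prob_space "uniform_sphere :: (real^'n) measure"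
    by (rule prob_space_uniform_sphere)
  interpret UN: pair_sigma_finite "uniform_sphere :: (real^'n) measure" ?N ..
  interpret G: product_prob_space "\<lambda>_. std_gauss :: (real^'n) measure"
    by (intro product_prob_spaceI prob_space_std_gauss)
  have "AE w in latent. gram_schmidt (frame w :: nat \<Rightarrow> real^'n) k \<noteq> 0" if k: "k < CARD('n)" for k
  proof -
    have "AE u in uniform_sphere. AE g in ?N. gram_schmidt (frame (u, g)) k \<noteq> 0"
    proof (cases k)
      case 0
      show ?thesis
        using AE_uniform_sphere_nonzero
        by eventually_elim (subst gram_schmidt.simps, simp add: 0 frame_def)
    next
      case (Suc i)
      with k have i: "i \<in> ?I" by auto
      then have ins: "insert i (?I - {i}) = ?I" by auto
      show ?thesis
      proof (rule AE_I2)
        fix u :: "real^'n"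
        let ?bad = "\<lambda>g. gram_schmidt (frame (u, g)) k = 0"
        have "(\<lambda>g. frame (u, g) j) \<in> borel_measurable ?N" for j
        proof (cases j)
          case (Suc l)
          then show ?thesis
            by (cases "l < CARD('n) - 1") (simp_all add: frame_def del: One_nat_def)
        qed (simp add: frame_def)
        then have [measurable]: "(\<lambda>g. gram_schmidt (frame (u, g)) k) \<in> borel_measurable ?N"
          by (rule measurable_gram_schmidt)
        have bad: "{g \<in> space ?N. ?bad g} \<in> sets ?N" by measurable
        \<comment> \<open>With all noise vectors but the \<open>i\<close>-th held fixed, a bad value
          at \<open>i\<close> lies in a fixed proper subspace.\<close>
        have inner0: "(\<integral>\<^sup>+y. indicator {g \<in> space ?N. ?bad g} (g(i := y)) \<partial>std_gauss) = 0" for g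
        proof -
          let ?S = "frame (u, g) ` {..<k}"
          have "card ?S < CARD('n)"
            using card_image_le[of "{..<k}" "frame (u, g)"] k by simp
          then have "AE y in std_gauss. y \<notin> span ?S"
            by (intro std_gauss_proper_span) auto
          moreover have "?bad (g(i := y)) \<Longrightarrow> y \<in> span ?S" for y
          proof -
            assume "?bad (g(i := y))"
            then have "frame (u, g(i := y)) k \<in> span (frame (u, g(i := y)) ` {..<k})"
              by (rule gram_schmidt_eq_0D)
            \<comment> \<open>Frame position \<open>k\<close> holds noise vector
              \<open>i = k - 1\<close>, so changing that vector leaves the earlier positions
              alone.\<close>
            moreover have "frame (u, g(i := y)) ` {..<k} = ?S"
              by (intro image_cong) (auto simp: frame_def Suc split: nat.split)
            ultimately show "y \<in> span ?S" using i by (simp add: frame_def Suc)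
          qed
          ultimately have "AE y in std_gauss. indicator {g \<in> space ?N. ?bad g} (g(i := y)) = (0::ennreal)"
            by (auto elim!: eventually_mono simp: indicator_def)
          then have "(\<integral>\<^sup>+y. indicator {g \<in> space ?N. ?bad g} (g(i := y)) \<partial>std_gauss) =
              (\<integral>\<^sup>+y. 0 \<partial>(std_gauss :: (real^'n) measure))"
            by (rule nn_integral_cong_AE)
          then show ?thesis by simp
        qed
        have "emeasure ?N {g \<in> space ?N. ?bad g} =
            (\<integral>\<^sup>+g. indicator {g \<in> space ?N. ?bad g} g \<partial>PiM (insert i (?I - {i})) (\<lambda>_. std_gauss))"
          unfolding ins by (rule nn_integral_indicator[symmetric]) measurable
        also have "\<dots> = (\<integral>\<^sup>+g. (\<integral>\<^sup>+y. indicator {g \<in> space ?N. ?bad g} (g(i := y)) \<partial>std_gauss)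
            \<partial>PiM (?I - {i}) (\<lambda>_. std_gauss))"
        proof (rule G.product_nn_integral_insert)
          show "indicator {g \<in> space ?N. ?bad g} \<in>
              borel_measurable (PiM (insert i (?I - {i})) (\<lambda>_. std_gauss))"
            unfolding ins by measurable
        qed auto
        also have "\<dots> = 0" by (simp only: inner0 nn_integral_const mult_zero_left)
        finally show "AE g in ?N. \<not> ?bad g"
          by (intro AE_I[of _ _ "{g \<in> space ?N. ?bad g}"] bad) auto
      qed
    qed
    moreover have "{w \<in> space latent. gram_schmidt (frame w :: nat \<Rightarrow> real^'n) k \<noteq> 0} \<in> sets latent"
      by measurable
    ultimately show ?thesis
      unfolding latent_def by (intro UN.AE_pair_measure)
  qed
  then have "AE w in latent. \<forall>k\<in>{..<CARD('n)}. gram_schmidt (frame w :: nat \<Rightarrow> real^'n) k \<noteq> 0"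
    by (intro AE_finite_allI) auto
  then show ?thesis by (simp add: Ball_def)
qed

text \<open>Reflect in a hyperplane containing the observations. It would fix the direction only if
  the normal were orthogonal to it, hence to every noise vector, which a frame with nonzero
  residuals excludes.\<close>

lemma exists_observation_preserving_reflection:
  fixes w :: "(real^'n) \<times> (nat \<Rightarrow> real^'n)"
  assumes good: "\<forall>k<CARD('n). gram_schmidt (frame w) k \<noteq> 0"
  obtains f where "orthogonal_transformation f" "\<And>v. f (f v) = v"
    "\<And>i. i < CARD('n) - 1 \<Longrightarrow> f (obs x w i) = obs x w i" "f (fst w) \<noteq> fst w"
proof -
  let ?I = "{..<CARD('n) - 1}"
  have "card (obs x w ` ?I) \<le> CARD('n) - 1"
    using card_image_le[of ?I "obs x w"] by simp
  \<comment> \<open>Positivity makes \<open>CARD('n) - 1 < CARD('n)\<close> strict under truncated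
    subtraction.\<close>
  moreover have "0 < CARD('n)" by simp
  ultimately have "dim (obs x w ` ?I) < DIM(real^'n)"
    using dim_le_card'[of "obs x w ` ?I"] by (simp del: zero_less_card_finite)
  then obtain m where m: "m \<noteq> 0" "\<And>y. y \<in> span (obs x w ` ?I) \<Longrightarrow> orthogonal m y"
    by (rule orthogonal_to_subspace_exists) blast
  define n where "n = sgn m"
  have n: "norm n = 1" and "n \<noteq> 0" using m by (auto simp: n_def norm_sgn sgn_zero_iff)
  have nz: "n \<bullet> obs x w i = 0" if "i < CARD('n) - 1" for i
    using m(2)[of "obs x w i"] that
    by (auto simp: n_def sgn_div_norm orthogonal_def span_base)
  have nu: "n \<bullet> fst w \<noteq> 0"
  proof
    assume 0: "n \<bullet> fst w = 0"
    \<comment> \<open>The terms of \<open>obs\<close> along the direction contribute nothing, which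
      leaves only the noise.\<close>
    have "n \<bullet> snd w i = 0" if "i < CARD('n) - 1" for i
      using nz[OF that] that 0 by (simp add: obs_def inner_add_right inner_diff_right)
    with 0 have "orthogonal n (frame w j)" for j
      by (auto simp: frame_def orthogonal_def split: nat.split)
    then have "orthogonal n (gram_schmidt (frame w) k)" for k
      by (intro orthogonal_to_span[OF gram_schmidt_in_span]) auto
    then have "sgn (gram_schmidt (frame w) k) \<bullet> n = 0" for k
      by (simp add: sgn_div_norm orthogonal_def inner_commute[of _ n])
    \<comment> \<open>A nonzero vector sent to 0 contradicts that \<open>frame_map\<close> preserves
      norms.\<close>
    then have "frame_map b (frame w) n = 0" for b
      by (simp add: frame_map_def)
    moreover obtain b :: "nat \<Rightarrow> real^'n" where "bij_betw b {..<DIM(real^'n)} Basis"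
      using ex_bij_betw_nat_finite[of "Basis :: (real^'n) set"] by (auto simp: lessThan_atLeast0)
    then have "orthogonal_transformation (frame_map b (frame w))"
      using good by (intro orthogonal_transformation_frame_map) auto
    then have "norm (frame_map b (frame w) n) = norm n"
      by (rule orthogonal_transformation_norm)
    ultimately show False using n by simp
  qed
  let ?f = "\<lambda>v. v - (2 * (n \<bullet> v)) *\<^sub>R n"
  show ?thesis
  proof (rule that)
    show "orthogonal_transformation ?f"
      by (rule orthogonal_transformation_reflection[OF n])
    have "n \<bullet> n = 1" using n by (simp add: dot_square_norm)
    then show "?f (?f v) = v" for v
      by (simp add: algebra_simps)
    show "?f (obs x w i) = obs x w i" if "i < CARD('n) - 1" for i
      using nz[OF that] by simp
    show "?f (fst w) \<noteq> fst w" using nu \<open>n \<noteq> 0\<close> by simp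
  qed
qed

section \<open>Averaging over a random rotation\<close>

lemma measurable_frame_map:
  assumes [measurable]: "(\<lambda>w. s w) \<in> measurable M latent" "v \<in> borel_measurable M"
  shows "(\<lambda>w. frame_map b (frame (s w)) (v w)) \<in> borel_measurable M"
  unfolding frame_map_def sgn_div_norm by measurable

lemma measurable_obs_component:
  fixes x :: "nat \<Rightarrow> real"
  assumes "i < CARD('n) - 1"
  shows "(\<lambda>w. obs x w i) \<in> borel_measurable (latent :: ((real^'n) \<times> (nat \<Rightarrow> real^'n)) measure)"
  using assms by (simp add: obs_def)

lemma latent_success_le_half:
  fixes x :: "nat \<Rightarrow> real" and est :: "(nat \<Rightarrow> real^'n) \<Rightarrow> real^'n"
  assumes est[measurable]: "est \<in> measurable data_space borel"
  shows "emeasure latent {w \<in> space latent. est (obs x w) = fst w} \<le> 1 / 2"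
proof -
  let ?I = "{..<CARD('n) - 1}"
  let ?M = "latent :: ((real^'n) \<times> (nat \<Rightarrow> real^'n)) measure"
  let ?good = "\<lambda>w::(real^'n) \<times> (nat \<Rightarrow> real^'n). \<forall>k<CARD('n). gram_schmidt (frame w) k \<noteq> 0"
  interpret M: prob_space ?M by (rule prob_space_latent)
  interpret MM: pair_prob_space ?M ?M ..
  note [measurable] = measurable_frame_map measurable_obs_component
  obtain b :: "nat \<Rightarrow> real^'n" where b: "bij_betw b {..<DIM(real^'n)} Basis"
    using ex_bij_betw_nat_finite[of "Basis :: (real^'n) set"] by (auto simp: lessThan_atLeast0)
  define Q where "Q w = frame_map b (frame w)" for w
  have Q: "orthogonal_transformation (Q w)" if "?good w" for w
    unfolding Q_def using that by (intro orthogonal_transformation_frame_map[OF b]) auto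
  have Q_meas[measurable]: "(\<lambda>w. Q (s w) (v w)) \<in> borel_measurable N"
    if "s \<in> measurable N latent" "v \<in> borel_measurable N" for s v and N :: "'z measure"
    unfolding Q_def using that by measurable
  have est_meas: "(\<lambda>w. est (\<lambda>i\<in>?I. h w i)) \<in> borel_measurable N"
    if "\<And>i. i < CARD('n) - 1 \<Longrightarrow> (\<lambda>w. h w i) \<in> borel_measurable N" for h and N :: "'z measure"
    by (rule measurable_compose[OF _ est]) (auto simp: data_space_def intro!: measurable_restrict that)
  define A where "A = {w \<in> space ?M. est (obs x w) = fst w}"
  have "(\<lambda>w. est (obs x w)) \<in> borel_measurable ?M"
    by (rule measurable_compose[OF _ est])
      (auto simp: data_space_def obs_def intro!: measurable_restrict)
  then have A[measurable]: "A \<in> sets ?M"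
    unfolding A_def by measurable
  \<comment> \<open>The first component of a pair supplies the rotation, the second the latent
    variables being rotated.\<close>
  define B where "B = {p \<in> space (?M \<Otimes>\<^sub>M ?M).
    est (\<lambda>i\<in>?I. Q (fst p) (obs x (snd p) i)) = Q (fst p) (fst (snd p))}"
  have "(\<lambda>p. est (\<lambda>i\<in>?I. Q (fst p) (obs x (snd p) i))) \<in> borel_measurable (?M \<Otimes>\<^sub>M ?M)"
    by (rule est_meas) measurable
  then have B[measurable]: "B \<in> sets (?M \<Otimes>\<^sub>M ?M)"
    unfolding B_def by measurable

  have "emeasure (?M \<Otimes>\<^sub>M ?M) B = (\<integral>\<^sup>+w'. emeasure ?M (Pair w' -` B) \<partial>?M)"
    by (rule M.emeasure_pair_measure_alt) measurable
  also have "\<dots> = (\<integral>\<^sup>+w'. emeasure ?M A \<partial>?M)"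
  proof (rule nn_integral_cong_AE)
    \<comment> \<open>For almost every \<open>w'\<close> the map \<open>Q w'\<close> is orthogonal,
      so the section of \<open>B\<close> is the preimage of \<open>A\<close> under the
      measure-preserving \<open>act (Q w')\<close>.\<close>
    show "AE w' in ?M. emeasure ?M (Pair w' -` B) = emeasure ?M A"
      using AE_frame_independent AE_space
    proof eventually_elim
      case (elim w')
      note QO = Q[OF elim(1)]
      have "emeasure ?M A = emeasure (distr ?M ?M (act (Q w'))) A"
        by (simp add: act_orthogonal_invariant[OF QO])
      also have "\<dots> = emeasure ?M (act (Q w') -` A \<inter> space ?M)"
        by (rule emeasure_distr) (auto intro: measurable_act[OF QO])
      also have "act (Q w') -` A \<inter> space ?M = Pair w' -` B"
        using elim(2) measurable_space[OF measurable_act[OF QO]]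
        by (auto simp: A_def B_def space_pair_measure obs_act[OF QO])
           (auto simp: act_def)
      finally show ?case ..
    qed
  qed
  finally have "emeasure ?M A = emeasure (?M \<Otimes>\<^sub>M ?M) B"
    by (simp add: M.emeasure_space_1)
  \<comment> \<open>Sections in the other direction: \<open>w\<close> is fixed and only the rotation
    is random.\<close>
  also have "\<dots> = (\<integral>\<^sup>+w. emeasure ?M ((\<lambda>w'. (w', w)) -` B) \<partial>?M)"
    by (rule MM.emeasure_pair_measure_alt2) measurable
  also have "\<dots> \<le> (\<integral>\<^sup>+w. 1 / 2 \<partial>?M)"
  proof (rule nn_integral_mono_AE)
    show "AE w in ?M. emeasure ?M ((\<lambda>w'. (w', w)) -` B) \<le> 1 / 2"
      using AE_frame_independent AE_space
    proof eventually_elim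
      case (elim w)
      obtain f where f: "orthogonal_transformation f" and ff: "\<And>v. f (f v) = v"
        and fz: "\<And>i. i < CARD('n) - 1 \<Longrightarrow> f (obs x w i) = obs x w i"
        and fu: "f (fst w) \<noteq> fst w"
        using exists_observation_preserving_reflection[OF elim(1)] by blast
      \<comment> \<open>To be used at two candidates, \<open>fst w\<close> and its mirror image,
        with the same data.\<close>
      define C where "C v = {w' \<in> space ?M. est (\<lambda>i\<in>?I. Q w' (obs x w i)) = Q w' v}" for v
      have "(\<lambda>w'. est (\<lambda>i\<in>?I. Q w' (obs x w i))) \<in> borel_measurable ?M"
        by (rule est_meas) measurable
      then have C[measurable]: "C v \<in> sets ?M" for v
        unfolding C_def by measurable
      \<comment> \<open>As \<open>f\<close> is an involution, acting on the sample that builds the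
        rotation precomposes the rotation with \<open>f\<close>.\<close>
      have Qf: "Q (act f w') v = Q w' (f v)" for w' v
        using frame_map_comp[OF f, of b "frame w'" "f v"] by (simp add: Q_def frame_act[OF f] ff)
      have "emeasure ?M (C (fst w)) = emeasure (distr ?M ?M (act f)) (C (fst w))"
        by (simp add: act_orthogonal_invariant[OF f])
      also have "\<dots> = emeasure ?M (act f -` C (fst w) \<inter> space ?M)"
        by (rule emeasure_distr) (auto intro: measurable_act[OF f])
      \<comment> \<open>The observations are fixed by \<open>f\<close>, so the estimate is
        unaffected and only the candidate changes.\<close>
      also have "act f -` C (fst w) \<inter> space ?M = C (f (fst w))"
        using measurable_space[OF measurable_act[OF f]]
        by (auto simp: C_def Qf fz cong: restrict_cong)
      finally have "emeasure ?M (C (fst w)) + emeasure ?M (C (fst w)) =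
          emeasure ?M (C (fst w)) + emeasure ?M (C (f (fst w)))"
        by simp
      also have "\<dots> = (\<integral>\<^sup>+w'. indicator (C (fst w)) w' + indicator (C (f (fst w))) w' \<partial>?M)"
        by (subst nn_integral_add) auto
      also have "\<dots> \<le> (\<integral>\<^sup>+w'. 1 \<partial>?M)"
      proof (rule nn_integral_mono_AE)
        \<comment> \<open>Off the null set where \<open>Q w'\<close> may fail to be injective, one
          estimate cannot equal two distinct vectors.\<close>
        show "AE w' in ?M. indicator (C (fst w)) w' + indicator (C (f (fst w))) w' \<le> (1::ennreal)"
          using AE_frame_independent
        proof eventually_elim
          case (elim w')
          have "Q w' (fst w) \<noteq> Q w' (f (fst w))"
            using orthogonal_transformation_inj[OF Q[OF elim]] fu by (simp add: inj_eq)
          then show ?case by (auto simp: C_def indicator_def)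
        qed
      qed
      finally have "2 * emeasure ?M (C (fst w)) \<le> 1"
        by (simp add: M.emeasure_space_1 mult_2)
      then have "emeasure ?M (C (fst w)) \<le> 1 / 2"
        using divide_right_mono_ennreal[of "2 * emeasure ?M (C (fst w))" 1 2]
        by (simp add: mult.commute[of 2] mult_divide_eq_ennreal)
      moreover have "(\<lambda>w'. (w', w)) -` B = C (fst w)"
        using elim(2) by (auto simp: B_def C_def space_pair_measure)
      ultimately show ?case by simp
    qed
  qed
  also have "\<dots> = 1 / 2" by (simp add: M.emeasure_space_1)
  finally show ?thesis by (simp add: A_def)
qed

section \<open>Return to the conditional laws of the data\<close>

theorem theorem5p1:
  fixes x :: "nat \<Rightarrow> real" and est :: "(nat \<Rightarrow> real^'n) \<Rightarrow> real^'n"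
  assumes "CARD('n) \<ge> 2"
    and "\<forall>i < CARD('n) - 1. x i \<in> {-1, 1}"
    and "est \<in> measurable (data_space :: (nat \<Rightarrow> real^'n) measure) borel"
    and "\<forall>z \<in> space (data_space :: (nat \<Rightarrow> real^'n) measure). est z \<in> sphere 0 1"
  shows "(\<integral>\<^sup>+ u. emeasure (data_given x u) {z \<in> space (data_given x u). est z = u}
            \<partial>(uniform_sphere :: (real^'n) measure)) \<le> 1 / 2"
proof -
  let ?N = "PiM {..<CARD('n) - 1} (\<lambda>_. std_gauss :: (real^'n) measure)"
  interpret N: prob_space ?N
    by (intro prob_space_PiM prob_space_std_gauss)
  note est[measurable] = assms(3)
  let ?A = "{w \<in> space latent. est (obs x w) = fst w}"
  have obs[measurable]: "obs x \<in> measurable latent data_space"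
    unfolding data_space_def obs_def by measurable
  have A: "?A \<in> sets latent" by measurable
  \<comment> \<open>For fixed \<open>u\<close>, the success event pulls back along
    \<open>obs\<close> to the section at \<open>u\<close> of the latent one; integrating these
    sections recovers its measure.\<close>
  have "emeasure (data_given x u) {z \<in> space (data_given x u). est z = u} =
      emeasure ?N (Pair u -` ?A)" for u
  proof -
    have meas: "(\<lambda>g. obs x (u, g)) \<in> measurable ?N data_space"
      unfolding data_space_def obs_def fst_conv snd_conv by measurable
    have "emeasure (data_given x u) {z \<in> space (data_given x u). est z = u} =
        emeasure ?N ((\<lambda>g. obs x (u, g)) -` {z \<in> space data_space. est z = u} \<inter> space ?N)"
      unfolding data_given_eq_distr space_distr by (rule emeasure_distr[OF meas]) measurable
    also have "(\<lambda>g. obs x (u, g)) -` {z \<in> space data_space. est z = u} \<inter> space ?N = Pair u -` ?A"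
      using measurable_space[OF meas] by (auto simp: latent_def space_pair_measure)
    finally show ?thesis .
  qed
  then have "(\<integral>\<^sup>+ u. emeasure (data_given x u) {z \<in> space (data_given x u). est z = u} \<partial>uniform_sphere) =
      (\<integral>\<^sup>+ u. emeasure ?N (Pair u -` ?A) \<partial>uniform_sphere)"
    by simp
  also have "\<dots> = emeasure latent ?A"
    using A unfolding latent_def by (rule N.emeasure_pair_measure_alt[symmetric])
  also have "\<dots> \<le> 1 / 2"
    by (rule latent_success_le_half[OF est])
  finally show ?thesis .
qed

end
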